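(* Let $V$ be a finite set, let $f_V=(f_v)_{v\in V}$ be a finite family of cusp forms with respect to a congruence subgroup of $SL_2(\mathbb{Z})$, let $s_V=(s_v)_{v\in V}$ be a family of complex numbers, and put $\omega_V=(\omega_v)_{v\in V}$, $\omega_v(z)=f_v(z)z^{s_v-1}dz$. Let $g_N=\begin{pmatrix}0&-1\\ N&0\end{pmatrix}$, acting on the upper half plane $H$ by $z\mapsto -1/(Nz)$. (i) If the linear space spanned by all $\omega_v$, $v\in V$, is stable with respect to the pull-back $g_N^*$ for some $N$, then the following functional equation holds: $$J_{i\infty}^0(\omega_V)=\big(g_{N*}(J_{i\infty}^0(\omega_V))\big)^{-1}.$$ Here $G=(g_{vu})_{v,u\in V}$ is the complex matrix of the action of $g_N^*$ on $(\omega_v)$, that is, $g_N^*(\omega_v)=\sum_u g_{vu}\omega_u$, and $g_{N*}$ acts on $\mathbb{C}\langle\langle A_V\rangle\rangle$ by $g_{N*}(A_u)=\sum_v A_v g_{vu}$, identically on coefficients. (ii) Denote the weight of $f_v$ by $2r_v$ and assume that each $f_v$ is an eigenvector for $g_N^*$ with eigenvalue $\varepsilon_v$, that is, $g_N^*(f_v(z)(dz)^{r_v})=\varepsilon_v f_v(z)(dz)^{r_v}$. Then the total Mellin transform satisfies $$TM(f_V;s_V)=\big(g_*(TM(f_V;2r_V-s_V))\big)^{-1},$$ where $2r_V-s_V=(2r_v-s_v)_{v\in V}$ and $g_*$ multiplies each $A_v$ by $\varepsilon_v N^{r_v-s_v}$.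
   Context: $H$ is the upper half plane with coordinate $z$. $\mathbb{C}\langle\langle A_V\rangle\rangle$ is the ring of associative formal power series in free noncommuting variables $A_v$, $v\in V$. Iterated integrals from the cusp $i\infty$ to the cusp $0$ are taken along the geodesic (the upper half of the imaginary axis) joining them: $$I_{i\infty}^0(\omega_{v_1},\dots,\omega_{v_n})=\int_{i\infty}^0\omega_{v_1}(z_1)\int_{i\infty}^{z_1}\omega_{v_2}(z_2)\cdots\int_{i\infty}^{z_{n-1}}\omega_{v_n}(z_n);$$ they converge for forms $f(z)z^{s-1}dz$ with $f$ a cusp form. The total iterated integral is $$J_{i\infty}^0(\omega_V)=1+\sum_{n\ge1}\sum_{(v_1,\dots,v_n)\in V^n}A_{v_1}\cdots A_{v_n}\,I_{i\infty}^0(\omega_{v_1},\dots,\omega_{v_n})\in\mathbb{C}\langle\langle A_V\rangle\rangle.$$ The total Mellin transform of $f_V=(f_v)$ with arguments $s_V=(s_v)$ is $TM(f_V;s_V):=J_{i\infty}^0(\omega_V)$, where $\omega_v=f_v(z)z^{s_v-1}dz$. The condition $g_N^*(f(z)(dz)^{r})=\varepsilon f(z)(dz)^{r}$ means $N^{r}f(-1/(Nz))(Nz)^{-2r}=\varepsilon f(z)$.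
   Formalization: In (ii), g_* multiplies A_v by ε_v N^{r_v-s_v} (-1)^{s_v-1}, with (-1)^{s-1}=e^{πi(s-1)} and z^{s-1} the principal branch; the printed constant without this factor fails, e.g. for f=Δ, N=1, s=r=6. *)

theory Defs
  imports
    "HOL-Analysis.Analysis"
    "HOL-Algebra.Group"
    "HOL-Number_Theory.Cong"
begin

section \<open>Formal power series in noncommuting variables\<close>

text \<open>A series with complex coefficients in the variables \<open>A\<^sub>v\<close>, \<open>v :: 'v\<close>, is given by the
  coefficients of the monomials \<open>A\<^sub>v\<^sub>1 \<cdots> A\<^sub>v\<^sub>n\<close>, indexed by the words \<open>[v\<^sub>1, \<dots>, v\<^sub>n]\<close>.  For a finite set
  \<open>V\<close> of indices, the ring of series in \<open>A\<^sub>V\<close> is the unital subring of the series whose coefficients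
  vanish at all words that are not words over \<open>V\<close>.\<close>

typedef 'v ncfps = "UNIV :: ('v list \<Rightarrow> complex) set"
  morphisms nc_coeff Abs_ncfps
  by simp

setup_lifting type_definition_ncfps

lemma ncfps_eqI: "(\<And>w. nc_coeff F w = nc_coeff G w) \<Longrightarrow> F = G"
  by (simp add: nc_coeff_inject[symmetric] fun_eq_iff)

instantiation ncfps :: (type) ring_1
begin

lift_definition zero_ncfps :: "'a ncfps" is "\<lambda>_. 0" .
lift_definition one_ncfps :: "'a ncfps" is "\<lambda>w. if w = [] then 1 else 0" .
lift_definition plus_ncfps :: "'a ncfps \<Rightarrow> 'a ncfps \<Rightarrow> 'a ncfps" is "\<lambda>F G w. F w + G w" .
lift_definition uminus_ncfps :: "'a ncfps \<Rightarrow> 'a ncfps" is "\<lambda>F w. - F w" .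
lift_definition minus_ncfps :: "'a ncfps \<Rightarrow> 'a ncfps \<Rightarrow> 'a ncfps" is "\<lambda>F G w. F w - G w" .
lift_definition times_ncfps :: "'a ncfps \<Rightarrow> 'a ncfps \<Rightarrow> 'a ncfps"
  is "\<lambda>F G w. \<Sum>i\<le>length w. F (take i w) * G (drop i w)" .

instance
proof
  fix a b c :: "'a ncfps"
  show "a * b * c = a * (b * c)"
  proof (transfer, rule ext)
    fix F G H :: "'a list \<Rightarrow> complex" and w :: "'a list"
    let ?n = "length w"
    let ?g = "\<lambda>i j. F (take i w) * G (take j (drop i w)) * H (drop (i + j) w)"
    have "(\<Sum>i\<le>?n. (\<Sum>j\<le>length (take i w). F (take j (take i w)) * G (drop j (take i w))) * H (drop i w))
        = (\<Sum>i\<le>?n. \<Sum>j\<le>i. ?g j (i - j))"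
      by (auto simp: sum_distrib_right min_def drop_take intro!: sum.cong)
    also have "\<dots> = (\<Sum>(i,j)\<in>{(i,j). i + j \<le> ?n}. ?g i j)"
      by (rule sum.triangle_reindex_eq[symmetric])
    also have "{(i,j). i + j \<le> ?n} = (SIGMA i:{..?n}. {..?n - i})"
      by auto
    also have "(\<Sum>(i,j)\<in>(SIGMA i:{..?n}. {..?n - i}). ?g i j) = (\<Sum>i\<le>?n. \<Sum>j\<le>?n - i. ?g i j)"
      by (subst sum.Sigma) auto
    also have "\<dots> = (\<Sum>i\<le>?n. F (take i w) *
        (\<Sum>j\<le>length (drop i w). G (take j (drop i w)) * H (drop j (drop i w))))"
      by (auto simp: sum_distrib_left mult.assoc add.commute intro!: sum.cong)
    finally show "(\<Sum>i\<le>?n. (\<Sum>j\<le>length (take i w). F (take j (take i w)) * G (drop j (take i w))) * H (drop i w))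
       = (\<Sum>i\<le>?n. F (take i w) *
        (\<Sum>j\<le>length (drop i w). G (take j (drop i w)) * H (drop j (drop i w))))" .
  qed
  show "1 * a = a"
  proof (transfer, rule ext)
    fix F :: "'a list \<Rightarrow> complex" and w :: "'a list"
    have "(\<Sum>i\<le>length w. (if take i w = [] then 1 else 0) * F (drop i w))
        = (\<Sum>i\<le>length w. if i = 0 then F w else 0)"
      by (intro sum.cong) auto
    then show "(\<Sum>i\<le>length w. (if take i w = [] then 1 else 0) * F (drop i w)) = F w"
      by simp
  qed
  show "a * 1 = a"
  proof (transfer, rule ext)
    fix F :: "'a list \<Rightarrow> complex" and w :: "'a list"
    have "(\<Sum>i\<le>length w. F (take i w) * (if drop i w = [] then 1 else 0))
        = (\<Sum>i\<le>length w. if i = length w then F w else 0)"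
      by (intro sum.cong) auto
    then show "(\<Sum>i\<le>length w. F (take i w) * (if drop i w = [] then 1 else 0)) = F w"
      by simp
  qed
  show "(a + b) * c = a * c + b * c"
    by transfer (simp add: sum.distrib distrib_right)
  show "a * (b + c) = a * b + a * c"
    by transfer (simp add: sum.distrib distrib_left)
  show "(0 :: 'a ncfps) \<noteq> 1"
    by transfer (auto simp: fun_eq_iff)
qed (transfer; simp add: fun_eq_iff)+

end

lift_definition nc_const :: "complex \<Rightarrow> 'v ncfps" is "\<lambda>c w. if w = [] then c else 0" .

lift_definition nc_var :: "'v \<Rightarrow> 'v ncfps" is "\<lambda>v w. if w = [v] then 1 else 0" .

definition nc_is_inverse :: "'v ncfps \<Rightarrow> 'v ncfps \<Rightarrow> bool" where
  "nc_is_inverse F G \<longleftrightarrow> F * G = 1 \<and> G * F = 1"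

text \<open>The substitution \<open>A\<^sub>u \<mapsto> \<Sum>\<^sub>v A\<^sub>v g\<^sub>v\<^sub>u\<close> (\<open>u, v \<in> V\<close>), identical on coefficients and continuous:
  the coefficient at \<open>v\<^sub>1 \<dots> v\<^sub>n\<close> of the image of \<open>F\<close> is the sum, over all words \<open>u\<^sub>1 \<dots> u\<^sub>n\<close> over \<open>V\<close>,
  of \<open>g\<^sub>v\<^sub>1\<^sub>u\<^sub>1 \<cdots> g\<^sub>v\<^sub>n\<^sub>u\<^sub>n\<close> times the coefficient of \<open>F\<close> at \<open>u\<^sub>1 \<dots> u\<^sub>n\<close>.\<close>

lift_definition nc_subst :: "'v set \<Rightarrow> ('v \<Rightarrow> 'v \<Rightarrow> complex) \<Rightarrow> 'v ncfps \<Rightarrow> 'v ncfps"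
  is "\<lambda>V g F w. if set w \<subseteq> V
        then \<Sum>u\<in>{u. set u \<subseteq> V \<and> length u = length w}. prod_list (map2 g w u) * F u
        else 0" .

definition diag_coeffs :: "('v \<Rightarrow> complex) \<Rightarrow> 'v \<Rightarrow> 'v \<Rightarrow> complex" where
  "diag_coeffs c v u = (if v = u then c v else 0)"

lemma nc_subst_const: "nc_subst V g (nc_const c) = nc_const c"
proof (rule ncfps_eqI)
  fix w :: "'a list"
  show "nc_coeff (nc_subst V g (nc_const c)) w = nc_coeff (nc_const c) w"
  proof (cases "w = []")
    case True
    have "{u :: 'a list. set u \<subseteq> V \<and> u = []} = {[]}" by auto
    with True show ?thesis by (simp add: nc_subst.rep_eq nc_const.rep_eq)
  next
    case False
    then show ?thesis
      by (auto simp: nc_subst.rep_eq nc_const.rep_eq intro!: sum.neutral)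
  qed
qed

lemma nc_subst_add: "nc_subst V g (F + G) = nc_subst V g F + nc_subst V g G"
  by (rule ncfps_eqI) (simp add: nc_subst.rep_eq plus_ncfps.rep_eq distrib_left sum.distrib)

lemma nc_subst_mult:
  "nc_subst V g (F * G) = nc_subst V g F * nc_subst V g G"
proof (rule ncfps_eqI)
  fix w :: "'a list"
  let ?L = "\<lambda>n. {u. set u \<subseteq> V \<and> length u = n}"
  let ?n = "length w"
  show "nc_coeff (nc_subst V g (F * G)) w = nc_coeff (nc_subst V g F * nc_subst V g G) w"
  proof (cases "set w \<subseteq> V")
    case True
    have sub: "set (take i w) \<subseteq> V" "set (drop i w) \<subseteq> V" for i
      using True by (meson order_trans set_take_subset set_drop_subset)+
    have key: "(\<Sum>u\<in>?L ?n. prod_list (map2 g w u) * (nc_coeff F (take i u) * nc_coeff G (drop i u)))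
       = (\<Sum>a\<in>?L (length (take i w)). prod_list (map2 g (take i w) a) * nc_coeff F a) *
         (\<Sum>b\<in>?L (length (drop i w)). prod_list (map2 g (drop i w) b) * nc_coeff G b)"
      if i: "i \<le> ?n" for i
    proof -
      have "(\<Sum>u\<in>?L ?n. prod_list (map2 g w u) * (nc_coeff F (take i u) * nc_coeff G (drop i u)))
         = (\<Sum>(a,b)\<in>?L (length (take i w)) \<times> ?L (length (drop i w)).
             prod_list (map2 g (take i w) a) * nc_coeff F a *
             (prod_list (map2 g (drop i w) b) * nc_coeff G b))"
      proof (rule sum.reindex_bij_witness[where j = "\<lambda>u. (take i u, drop i u)" and i = "\<lambda>(a,b). a @ b"])
        fix u assume u: "u \<in> ?L ?n"
        show "(case (take i u, drop i u) of (a, b) \<Rightarrow> a @ b) = u" by simp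
        show "(take i u, drop i u) \<in> ?L (length (take i w)) \<times> ?L (length (drop i w))"
          using u by (auto dest: in_set_takeD in_set_dropD)
        have "map2 g w u = map2 g (take i w @ drop i w) (take i u @ drop i u)" by simp
        also have "\<dots> = map2 g (take i w) (take i u) @ map2 g (drop i w) (drop i u)"
          using u by (subst zip_append) auto
        finally show "(case (take i u, drop i u) of (a, b) \<Rightarrow>
             prod_list (map2 g (take i w) a) * nc_coeff F a *
             (prod_list (map2 g (drop i w) b) * nc_coeff G b))
           = prod_list (map2 g w u) * (nc_coeff F (take i u) * nc_coeff G (drop i u))"
          by (simp add: mult_ac)
      qed (use i in auto)
      then show ?thesis by (simp add: sum_product sum.cartesian_product)
    qed
    have "nc_coeff (nc_subst V g (F * G)) w
       = (\<Sum>u\<in>?L ?n. \<Sum>i\<le>?n. prod_list (map2 g w u) * (nc_coeff F (take i u) * nc_coeff G (drop i u)))"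
      using True by (simp add: nc_subst.rep_eq times_ncfps.rep_eq sum_distrib_left)
    also have "\<dots> = (\<Sum>i\<le>?n. \<Sum>u\<in>?L ?n. prod_list (map2 g w u) * (nc_coeff F (take i u) * nc_coeff G (drop i u)))"
      by (rule sum.swap)
    also have "\<dots> = (\<Sum>i\<le>?n. (\<Sum>a\<in>?L (length (take i w)). prod_list (map2 g (take i w) a) * nc_coeff F a) *
         (\<Sum>b\<in>?L (length (drop i w)). prod_list (map2 g (drop i w) b) * nc_coeff G b))"
      by (intro sum.cong refl key) simp
    also have "\<dots> = nc_coeff (nc_subst V g F * nc_subst V g G) w"
      using sub by (simp add: nc_subst.rep_eq times_ncfps.rep_eq)
    finally show ?thesis .
  next
    case False
    have "\<not> (set (take i w) \<subseteq> V \<and> set (drop i w) \<subseteq> V)" for i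
      using False by (metis append_take_drop_id set_append le_sup_iff)
    then have "nc_coeff (nc_subst V g F) (take i w) * nc_coeff (nc_subst V g G) (drop i w) = 0" for i
      by (auto simp: nc_subst.rep_eq)
    then have "nc_coeff (nc_subst V g F * nc_subst V g G) w = 0"
      unfolding times_ncfps.rep_eq by (intro sum.neutral ballI)
    then show ?thesis using False by (simp add: nc_subst.rep_eq)
  qed
qed

lemma nc_subst_var:
  assumes "finite V" "u \<in> V"
  shows "nc_subst V g (nc_var u) = (\<Sum>v\<in>V. nc_var v * nc_const (g v u))"
proof (rule ncfps_eqI)
  fix w :: "'a list"
  have coeff_sum: "nc_coeff (\<Sum>v\<in>V. h v) w = (\<Sum>v\<in>V. nc_coeff (h v) w)" for h :: "'a \<Rightarrow> 'a ncfps"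
    using assms(1) by induction (simp_all add: zero_ncfps.rep_eq plus_ncfps.rep_eq)
  have vc: "nc_coeff (nc_var v * nc_const c) w = (if w = [v] then c else 0)" for v :: 'a and c
  proof -
    have "nc_coeff (nc_var v * nc_const c) w
        = (\<Sum>i\<le>length w. if i = length w then (if w = [v] then c else 0) else 0)"
      unfolding times_ncfps.rep_eq nc_var.rep_eq nc_const.rep_eq
      by (intro sum.cong) auto
    then show ?thesis by simp
  qed
  show "nc_coeff (nc_subst V g (nc_var u)) w = nc_coeff (\<Sum>v\<in>V. nc_var v * nc_const (g v u)) w"
  proof (cases "\<exists>x\<in>V. w = [x]")
    case True
    then obtain x where x: "x \<in> V" "w = [x]" by blast
    have fin: "finite {a. set a \<subseteq> V \<and> length a = Suc 0}"
      using finite_lists_length_eq[OF assms(1)] .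
    have "(\<Sum>a\<in>{a. set a \<subseteq> V \<and> length a = Suc 0}. prod_list (map2 g [x] a) * (if a = [u] then 1 else 0))
        = (\<Sum>a\<in>{a. set a \<subseteq> V \<and> length a = Suc 0}. if a = [u] then g x u else 0)"
      by (intro sum.cong) auto
    also have "\<dots> = g x u"
      using assms(2) fin by (simp add: sum.delta)
    finally have "nc_coeff (nc_subst V g (nc_var u)) w = g x u"
      using x by (simp add: nc_subst.rep_eq nc_var.rep_eq)
    moreover have "(\<Sum>v\<in>V. if w = [v] then g v u else 0) = (\<Sum>v\<in>V. if v = x then g v u else 0)"
      using x by (intro sum.cong) auto
    ultimately show ?thesis
      using x(1) assms(1) unfolding coeff_sum vc by simp
  next
    case False
    have "nc_coeff (nc_subst V g (nc_var u)) w = 0"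
      using False unfolding nc_subst.rep_eq nc_var.rep_eq
      by (force simp: length_Suc_conv Suc_length_conv intro!: sum.neutral)
    moreover have "(\<Sum>v\<in>V. if w = [v] then g v u else 0) = 0"
      using False by (intro sum.neutral) auto
    ultimately show ?thesis by (simp add: coeff_sum vc)
  qed
qed

section \<open>Cusp forms for congruence subgroups\<close>

definition upper_half_plane :: "complex set" where
  "upper_half_plane = {z. Im z > 0}"

definition mobius :: "int^2^2 \<Rightarrow> complex \<Rightarrow> complex" where
  "mobius A z = (of_int (A$1$1) * z + of_int (A$1$2)) / (of_int (A$2$1) * z + of_int (A$2$2))"

definition SL2Z :: "(int^2^2) monoid" where
  "SL2Z = \<lparr>carrier = {A. det A = 1}, mult = (**), one = mat 1\<rparr>"

lemma group_SL2Z: "group SL2Z"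
proof (rule groupI)
  fix A assume "A \<in> carrier SL2Z"
  then have A: "A$1$1 * A$2$2 - A$1$2 * A$2$1 = 1" by (simp add: SL2Z_def det_2)
  let ?B = "vector [vector [A$2$2, - A$1$2], vector [- A$2$1, A$1$1]] :: int^2^2"
  have "det ?B = 1" using A by (simp add: det_2 algebra_simps)
  moreover have "?B ** A = mat 1"
    using A by (simp add: vec_eq_iff forall_2 matrix_matrix_mult_def sum_2 mat_def algebra_simps)
  ultimately show "\<exists>B\<in>carrier SL2Z. B \<otimes>\<^bsub>SL2Z\<^esub> A = \<one>\<^bsub>SL2Z\<^esub>"
    by (auto simp: SL2Z_def)
qed (auto simp: SL2Z_def det_mul matrix_mul_assoc)

definition principal_congruence_subgroup :: "nat \<Rightarrow> (int^2^2) set" where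
  "principal_congruence_subgroup M =
     {A \<in> carrier SL2Z. \<forall>i j. [A$i$j = (mat 1 :: int^2^2)$i$j] (mod int M)}"

definition congruence_subgroup :: "(int^2^2) set \<Rightarrow> bool" where
  "congruence_subgroup \<Gamma> \<longleftrightarrow>
     subgroup \<Gamma> SL2Z \<and> (\<exists>M>0. principal_congruence_subgroup M \<subseteq> \<Gamma>)"

definition slash :: "int \<Rightarrow> int^2^2 \<Rightarrow> (complex \<Rightarrow> complex) \<Rightarrow> complex \<Rightarrow> complex" where
  "slash k A f z = (of_int (A$2$1) * z + of_int (A$2$2)) powi (- k) * f (mobius A z)"

text \<open>The cusps are the points \<open>A(i\<infinity>)\<close>, \<open>A \<in> SL\<^sub>2(\<int>)\<close>; vanishing at the cusp \<open>A(i\<infinity>)\<close> means that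
  \<open>f|\<^sub>kA\<close> tends to \<open>0\<close> as \<open>Im z \<rightarrow> \<infinity>\<close>, uniformly in \<open>Re z\<close>.  Forms are functions on
  the whole plane of which only the values on the upper half plane matter.\<close>

definition cusp_form :: "(int^2^2) set \<Rightarrow> int \<Rightarrow> (complex \<Rightarrow> complex) \<Rightarrow> bool" where
  "cusp_form \<Gamma> k f \<longleftrightarrow>
     f holomorphic_on upper_half_plane \<and>
     (\<forall>A\<in>\<Gamma>. \<forall>z\<in>upper_half_plane. slash k A f z = f z) \<and>
     (\<forall>A\<in>carrier SL2Z. (slash k A f \<longlongrightarrow> 0) (filtercomap Im at_top))"

section \<open>Iterated integrals and the total Mellin transform\<close>

text \<open>A holomorphic form \<open>\<omega>(z) dz\<close> on the upper half plane is represented by the function \<open>\<omega>\<close>.\<close>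

text \<open>\<open>iter_int [\<omega>\<^sub>1, \<dots>, \<omega>\<^sub>n] t\<close> is the integral
  \<open>\<integral>\<^bsub>i\<infinity>\<^esub>\<^bsup>it\<^esup> \<omega>\<^sub>1(z\<^sub>1) \<integral>\<^bsub>i\<infinity>\<^esub>\<^bsup>z\<^sub>1\<^esup> \<omega>\<^sub>2(z\<^sub>2) \<cdots>\<close> along the imaginary half axis, parametrized by \<open>z = iy\<close>, \<open>dz = i dy\<close>.\<close>

fun iter_int :: "(complex \<Rightarrow> complex) list \<Rightarrow> real \<Rightarrow> complex" where
  "iter_int [] t = 1"
| "iter_int (\<omega> # \<omega>s) t = (LBINT y=\<infinity>..ereal t. \<omega> (\<i> * of_real y) * iter_int \<omega>s y * \<i>)"

lift_definition total_iter_int :: "'v set \<Rightarrow> ('v \<Rightarrow> complex \<Rightarrow> complex) \<Rightarrow> 'v ncfps"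
  is "\<lambda>V \<omega> w. if set w \<subseteq> V then iter_int (map \<omega> w) 0 else 0" .

text \<open>The power is the principal branch, which is holomorphic on the upper half plane.\<close>

definition mellin_form :: "(complex \<Rightarrow> complex) \<Rightarrow> complex \<Rightarrow> complex \<Rightarrow> complex" where
  "mellin_form f s z = f z * z powr (s - 1)"

definition total_mellin ::
  "'v set \<Rightarrow> ('v \<Rightarrow> complex \<Rightarrow> complex) \<Rightarrow> ('v \<Rightarrow> complex) \<Rightarrow> 'v ncfps" where
  "total_mellin V f s = total_iter_int V (\<lambda>v. mellin_form (f v) (s v))"

section \<open>The involution \<open>g\<^sub>N\<close>\<close>

definition g_mat :: "nat \<Rightarrow> int^2^2" where
  "g_mat N = vector [vector [0, -1], vector [int N, 0]]"

lemma mobius_g_mat: "mobius (g_mat N) z = - 1 / (of_nat N * z)"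
  by (simp add: mobius_def g_mat_def)

definition pullback_form :: "(complex \<Rightarrow> complex) \<Rightarrow> (complex \<Rightarrow> complex) \<Rightarrow> complex \<Rightarrow> complex" where
  "pullback_form \<phi> \<omega> z = \<omega> (\<phi> z) * deriv \<phi> z"

definition form_span :: "'v set \<Rightarrow> ('v \<Rightarrow> complex \<Rightarrow> complex) \<Rightarrow> (complex \<Rightarrow> complex) set" where
  "form_span V \<omega> = {\<eta>. \<exists>c. \<forall>z\<in>upper_half_plane. \<eta> z = (\<Sum>v\<in>V. c v * \<omega> v z)}"

definition g_stable :: "nat \<Rightarrow> (complex \<Rightarrow> complex) set \<Rightarrow> bool" where
  "g_stable N S \<longleftrightarrow> (\<forall>\<eta>\<in>S. pullback_form (mobius (g_mat N)) \<eta> \<in> S)"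

text \<open>If the forms are linearly dependent, the matrix is not unique.\<close>

definition g_action_matrix ::
  "nat \<Rightarrow> 'v set \<Rightarrow> ('v \<Rightarrow> complex \<Rightarrow> complex) \<Rightarrow> ('v \<Rightarrow> 'v \<Rightarrow> complex) \<Rightarrow> bool" where
  "g_action_matrix N V \<omega> G \<longleftrightarrow>
     (\<forall>v\<in>V. \<forall>z\<in>upper_half_plane.
        pullback_form (mobius (g_mat N)) (\<omega> v) z = (\<Sum>u\<in>V. G v u * \<omega> u z))"

text \<open>The pull-back of \<open>f(z)(dz)\<^sup>r\<close> under \<open>z \<mapsto> -1/(Nz)\<close>, in terms of the weight \<open>k = 2r\<close>, so that odd
  weights (half-integral \<open>r\<close>) are included.\<close>

definition g_pullback_diff :: "nat \<Rightarrow> int \<Rightarrow> (complex \<Rightarrow> complex) \<Rightarrow> complex \<Rightarrow> complex" where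
  "g_pullback_diff N k f z =
     of_nat N powr (of_int k / 2) * f (mobius (g_mat N) z) * (of_nat N * z) powi (- k)"

definition g_eigenform :: "nat \<Rightarrow> int \<Rightarrow> complex \<Rightarrow> (complex \<Rightarrow> complex) \<Rightarrow> bool" where
  "g_eigenform N k \<epsilon> f \<longleftrightarrow> (\<forall>z\<in>upper_half_plane. g_pullback_diff N k f z = \<epsilon> * f z)"

text \<open>Pulling back \<open>z\<^bsup>s-1\<^esup>\<close> produces the constant \<open>(-1)\<^bsup>s-1\<^esup> = e\<^bsup>\<pi>i(s-1)\<^esup>\<close> (principal branch), which is
  \<open>1\<close> exactly when \<open>s\<close> is an odd integer.  It therefore occurs as a factor in the functional equation
  of the total Mellin transform; compare \<open>f = \<Delta>\<close>, \<open>N = 1\<close>, \<open>s = r = 6\<close>, where omitting it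
  would give \<open>\<Lambda>(\<Delta>; 6) = - \<Lambda>(\<Delta>; 6)\<close>.\<close>

lemma powr_g_mat:
  assumes "N > 0" "z \<in> upper_half_plane"
  shows "mobius (g_mat N) z powr (s - 1)
    = (-1) powr (s - 1) * of_nat N powr (1 - s) * z powr (1 - s)"
proof -
  have z: "Im z > 0" "z \<noteq> 0" using assms(2) by (auto simp: upper_half_plane_def)
  have "exp (\<i> * pi - of_real (ln (real N)) - Ln z) = - (1 / (of_nat N * z))"
    using z assms(1) by (simp add: exp_diff exp_of_real)
  moreover have "0 < Im (Ln z)" "Im (Ln z) < pi"
    using z Im_Ln_pos_lt_imp by auto
  ultimately have "Ln (- (1 / (of_nat N * z))) = \<i> * pi - of_real (ln (real N)) - Ln z"
    by (intro Ln_unique) auto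
  then have L: "Ln (mobius (g_mat N) z) = \<i> * pi - of_real (ln (real N)) - Ln z"
    by (simp add: mobius_g_mat)
  have "mobius (g_mat N) z \<noteq> 0"
    using z assms(1) by (simp add: mobius_g_mat)
  then have "mobius (g_mat N) z powr (s - 1)
      = exp ((s - 1) * (\<i> * pi - of_real (ln (real N)) - Ln z))"
    unfolding powr_def L by simp
  also have "(s - 1) * (\<i> * pi - of_real (ln (real N)) - Ln z)
      = (s - 1) * (\<i> * pi) + (1 - s) * of_real (ln (real N)) + (1 - s) * Ln z"
    by (simp add: algebra_simps)
  finally show ?thesis
    using z assms(1) by (simp add: powr_def Ln_of_nat exp_add)
qed

lemma minus_one_powr_odd:
  "((-1) powr (s - 1) :: complex) = 1 \<longleftrightarrow> (\<exists>m::int. s = of_int (2 * m + 1))"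
proof -
  have "((-1) powr (s - 1) :: complex) = exp ((s - 1) * (\<i> * pi))"
    by (simp add: powr_def)
  moreover have "exp ((s - 1) * (\<i> * pi)) = 1 \<longleftrightarrow> (\<exists>m::int. (s - 1) * (\<i> * pi) = of_real (2 * of_int m * pi) * \<i>)"
    unfolding exp_eq_1 by (auto simp: complex_eq_iff)
  moreover have "(s - 1) * (\<i> * pi) = of_real (2 * of_int m * pi) * \<i> \<longleftrightarrow> s = of_int (2 * m + 1)" for m :: int
  proof -
    have "(s - 1) * (\<i> * pi) = of_real (2 * of_int m * pi) * \<i> \<longleftrightarrow>
       (s - 1) * (\<i> * of_real pi) = (2 * of_int m) * (\<i> * of_real pi)"
      by (simp add: mult_ac)
    also have "\<dots> \<longleftrightarrow> s - 1 = 2 * of_int m" by simp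
    also have "\<dots> \<longleftrightarrow> s = of_int (2 * m + 1)" by (auto simp: algebra_simps)
    finally show ?thesis .
  qed
  ultimately show ?thesis by simp
qed

end

theory Submission
  imports Defs "HOL-Complex_Analysis.Complex_Analysis" "HOL-Real_Asymp.Real_Asymp" "HOL-Probability.Sinc_Integral"
begin

text \<open>
  The map \<open>g\<^sub>N\<close> sends the imaginary half axis to itself and exchanges its ends \<open>i\<infinity>\<close> and \<open>0\<close>.  Pull-back
  invariance of iterated integrals therefore turns the integral of \<open>\<omega>\<^sub>V\<close> from \<open>0\<close> to \<open>i\<infinity>\<close> into the integral of
  \<open>g\<^sub>N\<^sup>*(\<omega>\<^sub>V)\<close> from \<open>i\<infinity>\<close> to \<open>0\<close> (\<open>iterated_integral_inversion\<close>).  By multilinearity the latter is obtained from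
  the integral of the original forms, or for eigenforms of the forms with \<open>2r - s\<close> in place of \<open>s\<close>, by a linear
  substitution of the variables (\<open>iterated_integral_multilinear\<close>).  On the other hand the total integral
  from \<open>0\<close> to \<open>i\<infinity>\<close> is the two-sided inverse of the one from \<open>i\<infinity>\<close> to \<open>0\<close>.  This is Chen's composition formula
  (\<open>iterated_integral_composition\<close>) for a path followed by its reversal.

  All of this takes place on the half line \<open>y > 0\<close> with \<open>z = iy\<close>, for continuous and absolutely integrable
  functions of \<open>y\<close>.  That the forms \<open>f(z) z\<^bsup>s-1\<^esup> dz\<close> are of this kind is the analytic part: a cusp form is a
  function of \<open>q = exp (2\<pi>iz/M)\<close> with a removable singularity and a zero at \<open>q = 0\<close>, so it decays
  exponentially at \<open>i\<infinity>\<close> (\<open>periodic_exponential_decay\<close>); the same argument for \<open>f|S\<close>, with \<open>S(z) = -1/z\<close>,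
  gives the decay at \<open>0\<close>.
\<close>

section \<open>Iterated integrals on the half line\<close>

text \<open>A form on the imaginary half axis, written as a function of \<open>y = Im z\<close>.  Absolute integrability makes
  both cusps legitimate end points; continuity is what the change of variables needs.\<close>

definition path_form :: "(real \<Rightarrow> complex) \<Rightarrow> bool" where
  "path_form f \<longleftrightarrow> continuous_on {0<..} f \<and> set_integrable lborel {0<..} f"

text \<open>The end points are extended reals and the base point \<open>a\<close> is arbitrary, so that integrals from \<open>i\<infinity>\<close>
  to \<open>0\<close> and from \<open>0\<close> to \<open>i\<infinity>\<close> are instances of the same function.\<close>

fun iterated_integral :: "ereal \<Rightarrow> (real \<Rightarrow> complex) list \<Rightarrow> ereal \<Rightarrow> complex" where
  "iterated_integral a [] t = 1"
| "iterated_integral a (f # fs) t = (LBINT y=a..t. f y * iterated_integral a fs (ereal y))"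

lemma path_form_interval_integrable:
  assumes "path_form f" "0 \<le> a" "0 \<le> b"
  shows "interval_lebesgue_integrable lborel a b f"
proof -
  have "einterval a b \<subseteq> {0<..}" if "0 \<le> a" for a b :: ereal
    using that by (auto simp: einterval_iff dest: le_less_trans)
  then show ?thesis
    using assms unfolding path_form_def interval_lebesgue_integrable_def
    by (auto intro!: set_integrable_subset[of lborel "{0<..}"])
qed

lemma path_form_integral_append:
  assumes "path_form f" "0 \<le> a" "0 \<le> b" "0 \<le> c"
  shows "(LBINT y=a..b. f y) + (LBINT y=b..c. f y) = (LBINT y=a..c. f y)"
  using assms by (intro interval_integral_sum path_form_interval_integrable) (auto simp: min_def max_def)

lemma interval_integral_cong_pos:
  assumes "\<And>y. y > 0 \<Longrightarrow> f y = g y" "0 \<le> a" "0 \<le> b"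
  shows "(LBINT y=a..b. f y) = (LBINT y=a..b. g y)"
  using assms by (intro interval_integral_cong) (auto simp: einterval_iff min_def dest: le_less_trans split: if_splits)

lemma path_form_integral_bounded:
  assumes "path_form f"
  shows "\<exists>B. \<forall>a\<ge>0. \<forall>b\<ge>0. norm (LBINT y=a..b. f y) \<le> B"
proof (intro exI allI impI)
  fix a b :: ereal assume ab: "0 \<le> a" "0 \<le> b"
  have f: "set_integrable lborel {0<..} f" using assms by (simp add: path_form_def)
  have *: "norm (LBINT y:einterval a b. f y) \<le> (LBINT y:{0<..}. norm (f y))" if "0 \<le> a" for a b :: ereal
  proof -
    have sub: "einterval a b \<subseteq> {0<..}"
      using that by (auto simp: einterval_iff dest: le_less_trans)
    have "norm (LBINT y:einterval a b. f y) \<le> (LBINT y:einterval a b. norm (f y))"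
      by (rule set_integral_norm_bound[OF set_integrable_subset[OF f _ sub]]) simp
    also have "\<dots> \<le> (LBINT y:{0<..}. norm (f y))"
      using set_integrable_norm[OF f] set_integrable_norm[OF set_integrable_subset[OF f _ sub]] sub
      unfolding set_lebesgue_integral_def set_integrable_def
      by (intro integral_mono) (auto simp: indicator_def)
    finally show ?thesis .
  qed
  show "norm (LBINT y=a..b. f y) \<le> (LBINT y:{0<..}. norm (f y))"
    using *[OF ab(1), of b] *[OF ab(2), of a]
    by (simp add: interval_lebesgue_integral_def)
qed

lemma path_form_integral_continuous:
  assumes "path_form f" "0 \<le> a"
  shows "continuous_on {0<..} (\<lambda>t. LBINT y=a..ereal t. f y)"
proof -
  have "isCont (\<lambda>t. LBINT y=a..ereal t. f y) t" if t: "t > 0" for t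
  proof -
    have "((\<lambda>u. LBINT y=t..u. f y) has_vector_derivative f t) (at t within {t/2..2*t})"
      using assms(1) t by (intro interval_integral_FTC2) (auto simp: path_form_def intro: continuous_on_subset)
    then have "((\<lambda>u. LBINT y=t..u. f y) has_vector_derivative f t) (at t)"
      using t by (subst (asm) at_within_interior) auto
    then have "isCont (\<lambda>u. LBINT y=t..ereal u. f y) t"
      by (rule has_vector_derivative_continuous)
    then have "isCont (\<lambda>u. (LBINT y=a..ereal t. f y) + (LBINT y=t..ereal u. f y)) t"
      by (intro continuous_intros)
    moreover have "\<forall>\<^sub>F u in nhds t. (LBINT y=a..ereal t. f y) + (LBINT y=t..ereal u. f y) = (LBINT y=a..ereal u. f y)"
      using eventually_nhds_in_open[of "{0<..}" t] t
      by (auto elim!: eventually_mono intro!: path_form_integral_append assms)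
    ultimately show ?thesis by (simp cong: isCont_cong)
  qed
  then show ?thesis by (auto intro: continuous_at_imp_continuous_on)
qed

lemma path_form_mult_bounded:
  assumes "path_form f" "continuous_on {0<..} g" "\<And>y. y > 0 \<Longrightarrow> norm (g y) \<le> B"
  shows "path_form (\<lambda>y. f y * g y)"
proof -
  have c: "continuous_on {0<..} (\<lambda>y. f y * g y)"
    using assms by (intro continuous_intros) (auto simp: path_form_def)
  have "set_integrable lborel {0<..} (\<lambda>y. B *\<^sub>R f y)"
    using assms(1) by (intro set_integrable_scaleR_right) (simp add: path_form_def)
  then have "set_integrable lborel {0<..} (\<lambda>y. f y * g y)"
  proof (rule set_integrable_bound)
    show "set_borel_measurable lborel {0<..} (\<lambda>y. f y * g y)"
      using c unfolding set_borel_measurable_def by (auto intro!: borel_measurable_continuous_on_indicator)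
    have "norm (f y * g y) \<le> norm (B *\<^sub>R f y)" if "y > 0" for y
      using mult_left_mono[OF order_trans[OF assms(3)[OF that] abs_ge_self], of "norm (f y)"]
      by (simp add: norm_mult mult.commute)
    then show "AE y in lborel. y \<in> {0<..} \<longrightarrow> norm (f y * g y) \<le> norm (B *\<^sub>R f y)"
      by auto
  qed
  with c show ?thesis by (simp add: path_form_def)
qed

text \<open>Multiplying by an inner iterated integral does not leave the class of \<^const>\<open>path_form\<close>s, because the
  inner integral is bounded by the total mass of its integrand; hence all iterated integrals converge.\<close>

lemma iterated_integral_continuous_bounded:
  assumes "\<forall>f\<in>set fs. path_form f" "0 \<le> a"
  shows "continuous_on {0<..} (\<lambda>y. iterated_integral a fs (ereal y)) \<and> (\<exists>B. \<forall>t\<ge>0. norm (iterated_integral a fs t) \<le> B)"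
  using assms(1)
proof (induction fs)
  case Nil
  then show ?case by auto
next
  case (Cons f fs)
  then obtain B where B: "\<forall>t\<ge>0. norm (iterated_integral a fs t) \<le> B"
    and cont: "continuous_on {0<..} (\<lambda>y. iterated_integral a fs (ereal y))" by auto
  have pf: "path_form (\<lambda>y. f y * iterated_integral a fs (ereal y))"
    using Cons.prems B by (intro path_form_mult_bounded[where B = B] cont) auto
  show ?case
    using path_form_integral_continuous[OF pf assms(2)] path_form_integral_bounded[OF pf] assms(2)
    by auto
qed

lemma path_form_mult_iterated_integral:
  assumes "path_form f" "\<forall>f\<in>set fs. path_form f" "0 \<le> a"
  shows "path_form (\<lambda>y. f y * iterated_integral a fs (ereal y))"
proof -
  obtain B where "\<forall>t\<ge>0. norm (iterated_integral a fs t) \<le> B"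
    using iterated_integral_continuous_bounded[OF assms(2,3)] by auto
  then show ?thesis
    using iterated_integral_continuous_bounded[OF assms(2,3)]
    by (intro path_form_mult_bounded[where B = B] assms(1)) auto
qed

lemma iterated_integral_cong:
  assumes "list_all2 (\<lambda>f g. \<forall>y>0. f y = g y) fs gs" "0 \<le> a" "0 \<le> t"
  shows "iterated_integral a fs t = iterated_integral a gs t"
  using assms(1,3)
proof (induction arbitrary: t rule: list_all2_induct)
  case (Cons f fs g gs)
  then show ?case using assms(2) by (auto intro!: interval_integral_cong_pos)
qed simp

lemma path_form_sum:
  assumes "finite I" "\<And>i. i \<in> I \<Longrightarrow> path_form (h i)"
  shows "path_form (\<lambda>y. \<Sum>i\<in>I. h i y)"
  using assms
proof (induction I)
  case empty
  show ?case by (simp add: path_form_def set_integrable_def)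
next
  case (insert i I)
  then have "path_form (h i)" "path_form (\<lambda>y. \<Sum>i\<in>I. h i y)" by auto
  then have "path_form (\<lambda>y. h i y + (\<Sum>i\<in>I. h i y))"
    unfolding path_form_def by (intro conjI continuous_on_add set_integral_add) auto
  with insert.hyps show ?case by simp
qed

lemma path_form_integral_sum:
  assumes "finite I" "\<And>i. i \<in> I \<Longrightarrow> path_form (h i)" "0 \<le> a" "0 \<le> b"
  shows "(LBINT y=a..b. (\<Sum>i\<in>I. h i y)) = (\<Sum>i\<in>I. (LBINT y=a..b. h i y))"
  using assms(1,2)
proof (induction I)
  case empty
  show ?case by simp
next
  case (insert i I)
  then have "path_form (h i)" "path_form (\<lambda>y. \<Sum>i\<in>I. h i y)" by (auto intro: path_form_sum)
  then show ?case using insert assms(3,4) by (simp add: path_form_interval_integrable)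
qed

lemma path_form_cmult:
  assumes "path_form f" shows "path_form (\<lambda>y. c * f y)"
  using assms unfolding path_form_def by (auto intro: continuous_intros set_integrable_mult_right)

text \<open>Chen's formula for the composition of the paths from \<open>a\<close> to \<open>b\<close> and from \<open>b\<close> to \<open>t\<close>.  By induction: split the
  outermost integral at \<open>b\<close>; the part from \<open>a\<close> to \<open>b\<close> is the summand with \<open>i = 0\<close>, and in the part from \<open>b\<close> to
  \<open>t\<close> the inner integral is expanded by the induction hypothesis.  The points \<open>a\<close>, \<open>b\<close>, \<open>t\<close> may lie in any
  order, and \<open>t = a\<close> expresses that going back along a path inverts its total integral.\<close>

lemma iterated_integral_composition:
  assumes "\<forall>f\<in>set fs. path_form f" "0 \<le> a" "0 \<le> b" "0 \<le> t"
  shows "iterated_integral a fs t = (\<Sum>i\<le>length fs. iterated_integral b (take i fs) t * iterated_integral a (drop i fs) b)"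
  using assms(1,4)
proof (induction fs arbitrary: t)
  case Nil
  then show ?case by simp
next
  case (Cons f fs)
  let ?c = "\<lambda>i. iterated_integral a (drop i fs) b"
  have pa: "path_form (\<lambda>y. f y * iterated_integral a fs (ereal y))"
    using Cons.prems assms by (intro path_form_mult_iterated_integral) auto
  have pb: "path_form (\<lambda>y. ?c i * (f y * iterated_integral b (take i fs) (ereal y)))" for i
    using Cons.prems assms by (intro path_form_cmult path_form_mult_iterated_integral) (auto dest: in_set_takeD)
  have "(LBINT y=b..t. f y * iterated_integral a fs (ereal y))
      = (LBINT y=b..t. (\<Sum>i\<le>length fs. ?c i * (f y * iterated_integral b (take i fs) (ereal y))))"
    using Cons by (intro interval_integral_cong_pos assms)
       (auto simp: sum_distrib_left sum_distrib_right mult_ac)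
  also have "\<dots> = (\<Sum>i\<le>length fs. iterated_integral b (f # take i fs) t * ?c i)"
    using pb by (subst path_form_integral_sum) (auto simp: assms Cons.prems mult.commute)
  finally have "(LBINT y=b..t. f y * iterated_integral a fs (ereal y)) = (\<Sum>i\<le>length fs. iterated_integral b (f # take i fs) t * ?c i)" .
  moreover have "iterated_integral a (f # fs) t = iterated_integral a (f # fs) b + (LBINT y=b..t. f y * iterated_integral a fs (ereal y))"
    using path_form_integral_append[OF pa assms(2,3) Cons.prems(2)] by simp
  ultimately show ?case
    unfolding length_Cons sum.atMost_Suc_shift by simp
qed

lemma iterated_integral_same: "fs \<noteq> [] \<Longrightarrow> iterated_integral a fs a = 0"
  by (cases fs) auto

text \<open>This is how the substitution \<open>A\<^sub>u \<mapsto> \<Sum>\<^sub>v A\<^sub>v g\<^sub>v\<^sub>u\<close> of the variables arises from a linear substitution of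
  the forms.\<close>

lemma iterated_integral_multilinear:
  assumes "finite V" "\<And>u. u \<in> V \<Longrightarrow> path_form (h u)" "0 \<le> a" "0 \<le> t"
  shows "iterated_integral a (map (\<lambda>v y. \<Sum>u\<in>V. G v u * h u y) w) t
       = (\<Sum>u\<in>{u. set u \<subseteq> V \<and> length u = length w}. prod_list (map2 G w u) * iterated_integral a (map h u) t)"
  using assms(4)
proof (induction w arbitrary: t)
  case Nil
  have "{u. set u \<subseteq> V \<and> u = []} = {[]}" by auto
  then show ?case by simp
next
  case (Cons v w)
  let ?L = "{u. set u \<subseteq> V \<and> length u = length w}"
  have ph: "\<forall>f\<in>set (map h us). path_form f" if "us \<in> ?L" for us
    using that assms(2) by auto
  have fin: "finite (?L \<times> V)" using assms(1) by (simp add: finite_lists_length_eq)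
  have "iterated_integral a (map (\<lambda>v y. \<Sum>u\<in>V. G v u * h u y) (v # w)) t
     = (LBINT y=a..t. (\<Sum>(us, u)\<in>?L \<times> V. G v u * prod_list (map2 G w us) * (h u y * iterated_integral a (map h us) y)))"
    using Cons unfolding list.map iterated_integral.simps
    by (intro interval_integral_cong_pos assms)
       (simp_all add: sum_product sum.cartesian_product[symmetric] sum.swap[of _ V] mult_ac)
  also have "\<dots> = (\<Sum>(us, u)\<in>?L \<times> V. G v u * prod_list (map2 G w us) * iterated_integral a (map h (u # us)) t)"
    unfolding case_prod_unfold
    by (subst path_form_integral_sum[OF fin])
       (use assms Cons.prems ph in \<open>auto intro!: path_form_cmult path_form_mult_iterated_integral simp del: set_map\<close>)
  also have "\<dots> = (\<Sum>u\<in>{u. set u \<subseteq> V \<and> length u = length (v # w)}.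
      prod_list (map2 G (v # w) u) * iterated_integral a (map h u) t)"
    by (rule sum.reindex_bij_witness[where i = "\<lambda>u. (tl u, hd u)" and j = "\<lambda>(us, u). u # us"])
       (auto simp: length_Suc_conv Suc_length_conv)
  finally show ?case .
qed

lemma iter_int_eq_iterated_integral:
  "iter_int \<omega>s t = iterated_integral \<infinity> (map (\<lambda>\<omega> y. \<omega> (\<i> * of_real y) * \<i>) \<omega>s) (ereal t)"
proof (induction \<omega>s arbitrary: t)
  case (Cons \<omega> \<omega>s)
  show ?case unfolding iter_int.simps list.map iterated_integral.simps Cons by (simp add: mult_ac)
qed simp

section \<open>The inversion of the half line\<close>

text \<open>The pull-back under \<open>z \<mapsto> -1/(cz)\<close>, restricted to the imaginary half axis, on which this map is
  \<open>y \<mapsto> 1/(cy)\<close>.\<close>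

definition inversion_pullback :: "real \<Rightarrow> (real \<Rightarrow> complex) \<Rightarrow> real \<Rightarrow> complex" where
  "inversion_pullback c f y = f (1 / (c * y)) * of_real (- 1 / (c * y\<^sup>2))"

text \<open>Iterated integrals are compatible with pull-back.  The inversion exchanges the cusps, so the integral
  from \<open>0\<close> becomes one from \<open>\<infinity>\<close>.  The end point \<open>T = 0\<close> is included, with \<open>inverse 0 = \<infinity>\<close> in the extended
  reals.\<close>

lemma iterated_integral_inversion:
  assumes "c > 0" "\<forall>f\<in>set fs. path_form f \<and> path_form (inversion_pullback c f)" "0 \<le> T"
  shows "iterated_integral 0 fs (inverse (ereal c * T)) = iterated_integral \<infinity> (map (inversion_pullback c) fs) T"
  using assms(2,3)
proof (induction fs arbitrary: T)
  case Nil
  then show ?case by simp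
next
  case (Cons f fs)
  let ?R = "inversion_pullback c"
  let ?h = "\<lambda>y. f y * iterated_integral 0 fs (ereal y)"
  let ?F = "\<lambda>y. ?R f y * iterated_integral \<infinity> (map ?R fs) (ereal y)"
  show ?case
  proof (cases "T = \<infinity>")
    case True
    then show ?thesis using assms(1) by simp
  next
    case False
    with Cons.prems obtain t where T: "T = ereal t" "t \<ge> 0" by (cases T) auto
    \<comment> \<open>The reflection \<open>y = - x\<close> turns the decreasing map \<open>y \<mapsto> 1 / (c y)\<close> into the increasing \<open>g\<close>, to which
      the substitution rule applies; it also absorbs the minus sign in the pull-back.\<close>
    define g g' where "g = (\<lambda>x::real. - 1 / (c * x))" and "g' = (\<lambda>x::real. 1 / (c * x\<^sup>2))"
    have ph: "path_form ?h" and pF: "path_form ?F"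
      using Cons.prems by (auto intro!: path_form_mult_iterated_integral)
    have eq: "g' x *\<^sub>R ?h (g x) = - ?F (- x)" if "x < 0" for x
    proof -
      have "iterated_integral 0 fs (ereal (g x)) = iterated_integral \<infinity> (map ?R fs) (ereal (- x))"
        using Cons.IH[of "ereal (- x)"] Cons.prems that assms(1) by (simp add: g_def divide_inverse)
      then show ?thesis
        by (simp add: g_def g'_def inversion_pullback_def scaleR_conv_of_real)
    qed
    have neg: "x < 0" if "ereal x < ereal (- t)" for x using that T by simp
    have "(LBINT y=0..inverse (ereal c * T). ?h y) = (LBINT x=-\<infinity>..ereal (- t). g' x *\<^sub>R ?h (g x))"
    proof (rule interval_integral_substitution_integrable)
      fix x assume x: "ereal x < ereal (- t)"
      show "DERIV g x :> g' x"
        using neg[OF x] assms(1) unfolding g_def g'_def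
        by (auto intro!: derivative_eq_intros simp: power2_eq_square field_simps)
      have "g x \<in> {0<..}" using neg[OF x] assms(1) by (simp add: g_def field_simps mult_pos_neg)
      then show "isCont ?h (g x)"
        using ph by (auto simp: path_form_def continuous_on_eq_continuous_at)
      show "isCont g' x"
        using neg[OF x] assms(1) unfolding g'_def by (auto intro!: continuous_intros)
    next
      show "0 \<le> g' x" for x using assms(1) by (simp add: g'_def)
      show "((ereal \<circ> g \<circ> real_of_ereal) \<longlongrightarrow> 0) (at_right (-\<infinity>))"
      proof -
        have "(g \<longlongrightarrow> 0) at_bot" using assms(1) unfolding g_def by real_asymp
        then show ?thesis
          unfolding zero_ereal_def by (simp add: ereal_tendsto_simps)
      qed
      have "((\<lambda>x. ereal (g x)) \<longlongrightarrow> inverse (ereal c * T)) (at_left (- t))"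
      proof (cases "t = 0")
        case True
        have "filterlim g at_top (at_left 0)" using assms(1) unfolding g_def by real_asymp
        then show ?thesis
          using True T assms(1) by (simp add: tendsto_PInfty_eq_at_top)
      next
        case False
        have "(g \<longlongrightarrow> g (- t)) (at_left (- t))"
          unfolding g_def using False assms(1) by (intro tendsto_intros) auto
        then show ?thesis
          using False T assms(1) by (simp add: g_def divide_inverse)
      qed
      then show "((ereal \<circ> g \<circ> real_of_ereal) \<longlongrightarrow> inverse (ereal c * T)) (at_left (ereal (- t)))"
        by (simp only: ereal_tendsto_simps1 o_def[of ereal g])
      have "interval_lebesgue_integrable lborel (-\<infinity>) (ereal (- t)) (\<lambda>x. ?F (- x))"
        using interval_integrable_mirror[of "-\<infinity>" "ereal (- t)" ?F] T
          path_form_interval_integrable[OF pF, of "ereal t" \<infinity>] by simp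
      then have "set_integrable lborel (einterval (-\<infinity>) (ereal (- t))) (\<lambda>x. - ?F (- x))"
        by (simp add: interval_lebesgue_integrable_def set_integrable_def)
      then show "set_integrable lborel (einterval (-\<infinity>) (ereal (- t))) (\<lambda>x. g' x *\<^sub>R ?h (g x))"
        by (rule set_integrable_cong[THEN iffD1, rotated -1]) (use eq neg in \<open>auto simp: einterval_iff\<close>)
      have "0 \<le> inverse (ereal c * T)" using T assms(1) by (cases "t = 0") auto
      then show "set_integrable lborel (einterval 0 (inverse (ereal c * T))) ?h"
        using path_form_interval_integrable[OF ph, of 0 "inverse (ereal c * T)"]
        by (simp add: interval_lebesgue_integrable_def)
    qed simp
    also have "\<dots> = (LBINT x=-\<infinity>..ereal (- t). - ?F (- x))"
      by (intro interval_integral_cong) (use eq neg in \<open>auto simp: einterval_iff min_def\<close>)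
    also have "\<dots> = - (LBINT x=-\<infinity>..ereal (- t). ?F (- x))"
      by (rule interval_lebesgue_integral_uminus)
    also have "\<dots> = (LBINT x=ereal (- t)..-\<infinity>. ?F (- x))"
      by (rule interval_integral_endpoints_reverse[symmetric])
    also have "\<dots> = (LBINT y=\<infinity>..T. ?F y)"
      using interval_integral_reflect[of \<infinity> T ?F] by (simp add: T)
    finally show ?thesis by simp
  qed
qed

section \<open>Decay of cusp forms\<close>

lemma periodic_int_multiple:
  fixes F :: "complex \<Rightarrow> 'a" and M :: real
  assumes "\<And>z. z \<in> upper_half_plane \<Longrightarrow> F (z + of_real M) = F z" "z \<in> upper_half_plane"
  shows "F (z + of_int n * of_real M) = F z"
proof -
  have *: "F (z + of_nat n * of_real M) = F z" if "z \<in> upper_half_plane" for n z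
  proof (induction n)
    case (Suc n)
    have "z + of_nat n * of_real M \<in> upper_half_plane"
      using that by (simp add: upper_half_plane_def)
    from assms(1)[OF this] show ?case using Suc by (simp add: algebra_simps)
  qed simp
  show ?thesis
  proof (cases "n \<ge> 0")
    case True
    then show ?thesis using *[OF assms(2), of "nat n"] by simp
  next
    case False
    have "z + of_int n * of_real M \<in> upper_half_plane"
      using assms(2) by (simp add: upper_half_plane_def)
    from *[OF this, of "nat (-n)"] False show ?thesis by (simp add: algebra_simps)
  qed
qed

text \<open>In the coordinate \<open>q = exp (2\<pi>iz/M)\<close> the function becomes a holomorphic function \<open>h\<close> on the punctured
  unit disc which tends to \<open>0\<close> at the origin.  The singularity is removable and \<open>h\<close> vanishes there, so
  \<open>h(q) = O(q)\<close>.\<close>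

lemma periodic_exponential_decay:
  assumes hol: "F holomorphic_on upper_half_plane" and M: "M > 0"
    and per: "\<And>z. z \<in> upper_half_plane \<Longrightarrow> F (z + of_real M) = F z"
    and lim: "(F \<longlongrightarrow> 0) (filtercomap Im at_top)"
  shows "\<exists>C Y. \<forall>z. Im z \<ge> Y \<longrightarrow> norm (F z) \<le> C * exp (- (2 * pi / M) * Im z)"
proof -
  define e where "e = complex_of_real (M / (2 * pi)) * (- \<i>)"
  have e: "e * (2 * pi * \<i>) = of_real M" using M by (simp add: e_def)
  have Im_e: "Im (e * w) = - (M / (2 * pi)) * Re w" for w by (simp add: e_def)
  note times_complex.sel [simp del]
  have up: "e * Ln q \<in> upper_half_plane" if "norm q < 1" "q \<noteq> 0" for q
    using that M by (simp add: upper_half_plane_def Im_e mult_pos_neg divide_neg_pos)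
  define h where "h q = (if q = 0 then 0 else F (e * Ln q))" for q
  \<comment> \<open>By periodicity \<open>h\<close> may also be computed from the branch of the logarithm that is cut along
    the positive reals; the two branches cover the punctured disc.\<close>
  have h_alt: "h q = F (e * (Ln (- q) + \<i> * pi))" if "norm q < 1" "q \<noteq> 0" for q
  proof -
    have "Ln (- q) + \<i> * pi = Ln q \<or> Ln (- q) + \<i> * pi = Ln q + 2 * pi * \<i>"
      using Ln_minus[OF that(2)] by (auto split: if_splits)
    then have "e * (Ln (- q) + \<i> * pi) = e * Ln q \<or> e * (Ln (- q) + \<i> * pi) = e * Ln q + of_real M"
      by (metis e distrib_left)
    then show ?thesis using per[OF up[OF that]] that(2) by (auto simp: h_def)
  qed
  have "(\<lambda>q. F (e * Ln q)) holomorphic_on (ball 0 1 - \<real>\<^sub>\<le>\<^sub>0)"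
    by (rule holomorphic_on_compose_gen[OF _ hol, unfolded o_def])
       (auto intro!: holomorphic_intros up)
  then have h1: "h holomorphic_on (ball 0 1 - \<real>\<^sub>\<le>\<^sub>0)"
    by (rule holomorphic_transform) (auto simp: h_def)
  have up': "e * (Ln (- q) + \<i> * pi) \<in> upper_half_plane" if "norm q < 1" "q \<noteq> 0" for q
    using up[of "- q"] that by (simp add: upper_half_plane_def Im_e)
  have "(\<lambda>q. F (e * (Ln (- q) + \<i> * pi))) holomorphic_on (ball 0 1 - \<real>\<^sub>\<ge>\<^sub>0)"
    by (rule holomorphic_on_compose_gen[OF _ hol, unfolded o_def])
       (auto intro!: holomorphic_intros up' simp: uminus_nonneg_Reals_iff[symmetric] complex_nonpos_Reals_iff complex_nonneg_Reals_iff)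
  then have h2: "h holomorphic_on (ball 0 1 - \<real>\<^sub>\<ge>\<^sub>0)"
    by (rule holomorphic_transform) (metis Diff_iff h_alt mem_ball_0 nonneg_Reals_zero_I)
  have "h holomorphic_on (ball 0 1 - \<real>\<^sub>\<le>\<^sub>0) \<union> (ball 0 1 - \<real>\<^sub>\<ge>\<^sub>0)"
    by (intro holomorphic_on_Un h1 h2 open_Diff) auto
  also have "(ball 0 1 - \<real>\<^sub>\<le>\<^sub>0) \<union> (ball 0 1 - \<real>\<^sub>\<ge>\<^sub>0) = ball (0::complex) 1 - {0}"
    by (auto simp: complex_nonpos_Reals_iff complex_nonneg_Reals_iff complex_eq_iff)
  finally have hol_h: "h holomorphic_on ball 0 1 - {0}" .
  have "filterlim (\<lambda>q. Im (e * Ln q)) at_top (at 0)"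
  proof -
    have "filterlim (\<lambda>q::complex. norm q) (at_right 0) (at 0)"
      by (auto simp: filterlim_at tendsto_norm_zero eventually_at_filter)
    moreover have "filterlim (\<lambda>x. - (M / (2 * pi)) * ln x) at_top (at_right 0)"
      using M by real_asymp
    ultimately have "filterlim (\<lambda>q::complex. - (M / (2 * pi)) * ln (norm q)) at_top (at 0)"
      using filterlim_compose by blast
    then show ?thesis
      by (rule filterlim_cong[THEN iffD1, rotated -1]) (auto simp: eventually_at_filter Im_e intro!: always_eventually)
  qed
  then have "filterlim (\<lambda>q. e * Ln q) (filtercomap Im at_top) (at 0)"
    by (simp add: filterlim_filtercomap_iff o_def)
  then have "((\<lambda>q. F (e * Ln q)) \<longlongrightarrow> 0) (at 0)"
    using lim filterlim_compose by blast
  then have "(h \<longlongrightarrow> h 0) (at 0)"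
    by (rule filterlim_cong[THEN iffD1, rotated -1]) (auto simp: eventually_at_filter h_def intro!: always_eventually)
  then have "isCont h 0" by (simp add: isCont_def)
  then have "continuous_on (ball 0 1) h"
    using holomorphic_on_imp_continuous_on[OF hol_h]
    by (metis continuous_at_imp_continuous_on continuous_on_eq_continuous_at Diff_iff empty_iff insert_iff open_ball open_delete)
  then have "h holomorphic_on ball 0 1"
    using hol_h by (rule no_isolated_singularity) auto
  then obtain D where "(h has_field_derivative D) (at 0)"
    by (metis centre_in_ball field_differentiable_def holomorphic_on_imp_differentiable_at open_ball zero_less_one)
  then have "((\<lambda>q. h q / q) \<longlongrightarrow> D) (at 0)"
    by (simp add: has_field_derivative_iff h_def)
  then have "\<forall>\<^sub>F q in at 0. norm (h q / q) < norm D + 1"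
    by (intro order_tendstoD(2)[OF tendsto_norm]) auto
  then obtain d where d: "d > 0" "\<And>q. q \<noteq> 0 \<Longrightarrow> norm q < d \<Longrightarrow> norm (h q / q) < norm D + 1"
    by (auto simp: eventually_at)
  have "\<forall>\<^sub>F y in at_top. exp (- (2 * pi / M) * y) < d"
  proof (rule order_tendstoD(2)[OF _ d(1)])
    show "((\<lambda>y. exp (- (2 * pi / M) * y)) \<longlongrightarrow> 0) at_top" using M by real_asymp
  qed
  then obtain Y where Y: "\<And>y. y \<ge> Y \<Longrightarrow> exp (- (2 * pi / M) * y) < d"
    by (auto simp: eventually_at_top_linorder)
  have "norm (F z) \<le> (norm D + 1) * exp (- (2 * pi / M) * Im z)" if z: "Im z \<ge> max Y 1" for z
  proof -
    define q where "q = exp (2 * pi * \<i> / of_real M * z)"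
    have nq: "norm q = exp (- (2 * pi / M) * Im z)"
      by (simp add: q_def norm_exp_eq_Re times_complex.sel)
    have "q \<noteq> 0" by (simp add: q_def)
    then have "exp (Ln q) = exp (2 * pi * \<i> / of_real M * z)" by (simp add: q_def)
    then obtain n :: int where "Ln q = 2 * pi * \<i> / of_real M * z + of_int (2 * n) * pi * \<i>"
      using exp_eq by auto
    then have "e * Ln q = e * (2 * pi * \<i>) * (z / of_real M + of_int n)"
      by (simp add: algebra_simps)
    also have "\<dots> = z + of_int n * of_real M" using M unfolding e by (simp add: field_simps)
    finally have "h q = F z"
      using periodic_int_multiple[of F M z n] per z \<open>q \<noteq> 0\<close> by (simp add: h_def upper_half_plane_def)
    moreover have "norm (h q / q) < norm D + 1" using d(2) Y nq z \<open>q \<noteq> 0\<close> by auto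
    ultimately have "norm (F z) < (norm D + 1) * norm q"
      using \<open>q \<noteq> 0\<close> by (simp add: norm_divide divide_less_eq)
    then show ?thesis by (simp add: nq)
  qed
  then show ?thesis by blast
qed

definition S_mat :: "int^2^2" where
  "S_mat = vector [vector [0, -1], vector [1, 0]]"

lemma slash_translation_invariant:
  assumes "congruence_subgroup \<Gamma>" "cusp_form \<Gamma> k f"
  obtains M :: real where "M > 0"
    "\<And>z. z \<in> upper_half_plane \<Longrightarrow> f (z + of_real M) = f z"
    "\<And>z. z \<in> upper_half_plane \<Longrightarrow> slash k S_mat f (z + of_real M) = slash k S_mat f z"
proof -
  obtain m where m: "m > 0" "principal_congruence_subgroup m \<subseteq> \<Gamma>"
    using assms(1) by (auto simp: congruence_subgroup_def)
  \<comment> \<open>\<open>A\<close> is the conjugate of \<open>T\<close> by \<open>S\<close>, so that invariance of \<open>f\<close> under \<open>A\<close> is invariance of \<open>f|S\<close>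
    under the translation \<open>T\<close>.\<close>
  define T where "T = (vector [vector [1, int m], vector [0, 1]] :: int^2^2)"
  define A where "A = (vector [vector [1, 0], vector [- int m, 1]] :: int^2^2)"
  have "T \<in> \<Gamma>" "A \<in> \<Gamma>"
    using m(2) by (auto simp: T_def A_def principal_congruence_subgroup_def SL2Z_def det_2 forall_2 mat_def
        cong_def subset_iff)
  then have T: "\<And>z. z \<in> upper_half_plane \<Longrightarrow> slash k T f z = f z"
    and A: "\<And>z. z \<in> upper_half_plane \<Longrightarrow> slash k A f z = f z"
    using assms(2) by (auto simp: cusp_form_def)
  show ?thesis
  proof (rule that[of "real m"])
    show "real m > 0" using m by simp
    fix z assume z: "z \<in> upper_half_plane"
    show "f (z + of_real (real m)) = f z"
      using T[OF z] by (simp add: slash_def T_def mobius_def)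
    have z0: "z \<noteq> 0" "z + of_nat m \<noteq> 0" using z by (auto simp: upper_half_plane_def complex_eq_iff)
    define w where "w = - 1 / z"
    have w: "w \<in> upper_half_plane"
      using z by (simp add: w_def upper_half_plane_def Im_divide divide_neg_pos sum_power2_gt_zero_iff)
    have den: "- of_nat m * w + 1 = (z + of_nat m) / z" using z0 by (simp add: w_def field_simps)
    have "mobius A w = w / (- of_nat m * w + 1)" by (simp add: mobius_def A_def)
    also have "\<dots> = - 1 / (z + of_nat m)" unfolding den using z0 by (simp add: w_def)
    finally have mob: "mobius A w = - 1 / (z + of_nat m)" .
    have "f w = (- of_nat m * w + 1) powi (- k) * f (mobius A w)"
      using A[OF w] by (simp add: slash_def A_def)
    then have "f w = (z + of_nat m) powi (- k) / z powi (- k) * f (- 1 / (z + of_nat m))"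
      unfolding den mob power_int_divide_distrib .
    then have "z powi (- k) * f w = (z + of_nat m) powi (- k) * f (- 1 / (z + of_nat m))"
      using z0 by simp
    then show "slash k S_mat f (z + of_real (real m)) = slash k S_mat f z"
      by (simp add: slash_def S_mat_def mobius_def w_def)
  qed
qed

lemma slash_S_holomorphic:
  assumes "f holomorphic_on upper_half_plane"
  shows "slash k S_mat f holomorphic_on upper_half_plane"
proof -
  have "(\<lambda>z. z powi (- k) * f (- 1 / z)) holomorphic_on upper_half_plane"
  proof (intro holomorphic_on_mult holomorphic_on_compose_gen[OF _ assms, unfolded o_def])
    show "(\<lambda>z. z powi - k) holomorphic_on upper_half_plane" "(\<lambda>z. - 1 / z) holomorphic_on upper_half_plane"
      by (auto intro!: holomorphic_intros simp: upper_half_plane_def)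
    show "(\<lambda>z. - 1 / z) ` upper_half_plane \<subseteq> upper_half_plane"
      by (auto simp: upper_half_plane_def Im_divide divide_neg_pos sum_power2_gt_zero_iff)
  qed
  then show ?thesis
    by (rule holomorphic_transform) (simp add: slash_def S_mat_def mobius_def)
qed

text \<open>The decay towards \<open>0\<close> is the decay of \<open>f|S\<close> towards \<open>i\<infinity>\<close>.\<close>

lemma cusp_form_decay:
  assumes "congruence_subgroup \<Gamma>" "cusp_form \<Gamma> k f"
  obtains C c Y where "c > 0"
    "\<And>y. y \<ge> Y \<Longrightarrow> norm (f (\<i> * of_real y)) \<le> C * exp (- c * y)"
    "\<And>y. y > 0 \<Longrightarrow> 1 / y \<ge> Y \<Longrightarrow> norm (f (\<i> * of_real y)) \<le> C * exp (- c / y) * y powr (- of_int k)"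
proof -
  from slash_translation_invariant[OF assms] obtain M :: real where M: "M > 0"
    "\<And>z. z \<in> upper_half_plane \<Longrightarrow> f (z + of_real M) = f z"
    "\<And>z. z \<in> upper_half_plane \<Longrightarrow> slash k S_mat f (z + of_real M) = slash k S_mat f z"
    by metis
  have hol: "f holomorphic_on upper_half_plane" using assms(2) by (simp add: cusp_form_def)
  have lim: "(slash k A f \<longlongrightarrow> 0) (filtercomap Im at_top)" if "A \<in> carrier SL2Z" for A
    using assms(2) that by (auto simp: cusp_form_def)
  have one: "slash k (mat 1) f = f"
    by (rule ext) (simp add: slash_def mobius_def mat_def)
  have "mat 1 \<in> carrier SL2Z" "S_mat \<in> carrier SL2Z"
    by (simp_all add: SL2Z_def S_mat_def det_2 mat_def)
  note l = lim[OF this(1), unfolded one] lim[OF this(2)]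
  obtain C1 Y1 where 1: "\<And>z. Im z \<ge> Y1 \<Longrightarrow> norm (f z) \<le> C1 * exp (- (2 * pi / M) * Im z)"
    using periodic_exponential_decay[OF hol M(1,2) l(1)] by auto
  obtain C2 Y2 where 2: "\<And>z. Im z \<ge> Y2 \<Longrightarrow> norm (slash k S_mat f z) \<le> C2 * exp (- (2 * pi / M) * Im z)"
    using periodic_exponential_decay[OF slash_S_holomorphic[OF hol] M(1,3) l(2)] by auto
  show ?thesis
  proof (rule that[of "2 * pi / M" "max Y1 Y2" "max C1 C2"])
    show "2 * pi / M > 0" using M by simp
    show "norm (f (\<i> * of_real y)) \<le> max C1 C2 * exp (- (2 * pi / M) * y)" if "y \<ge> max Y1 Y2" for y
      using 1[of "\<i> * of_real y"] that
      by (auto intro: order_trans[OF _ mult_right_mono[of C1 "max C1 C2"]])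
    show "norm (f (\<i> * of_real y)) \<le> max C1 C2 * exp (- (2 * pi / M) / y) * y powr (- of_int k)"
      if y: "y > 0" "1 / y \<ge> max Y1 Y2" for y
    proof -
      let ?z = "\<i> * of_real (1 / y)"
      have "slash k S_mat f ?z = ?z powi (- k) * f (\<i> * of_real y)"
        using y by (simp add: slash_def S_mat_def mobius_def field_simps)
      moreover have "norm (?z powi (- k)) = y powr of_int k"
        using y by (simp add: norm_power_int power_int_minus powr_real_of_int' norm_divide power_int_divide_distrib)
      ultimately have "y powr of_int k * norm (f (\<i> * of_real y)) \<le> C2 * exp (- (2 * pi / M) / y)"
        using 2[of ?z] y by (simp add: norm_mult)
      also have "\<dots> \<le> max C1 C2 * exp (- (2 * pi / M) / y)" by (intro mult_right_mono) auto
      finally show ?thesis using y by (simp add: powr_minus field_simps)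
    qed
  qed
qed

section \<open>Integrability of the Mellin forms\<close>

lemma bounded_on_half_line:
  fixes h :: "real \<Rightarrow> complex"
  assumes "continuous_on {0<..} h" "(h \<longlongrightarrow> 0) (at_right 0)" "(h \<longlongrightarrow> 0) at_top"
  shows "\<exists>K. \<forall>y>0. norm (h y) \<le> K"
proof -
  have "\<forall>\<^sub>F y in at_right 0. norm (h y) < 1" "\<forall>\<^sub>F y in at_top. norm (h y) < 1"
    using order_tendstoD(2)[OF tendsto_norm[OF assms(2)], of 1]
      order_tendstoD(2)[OF tendsto_norm[OF assms(3)], of 1] by auto
  then obtain d Y where d: "d > 0" "\<And>y. 0 < y \<Longrightarrow> y < d \<Longrightarrow> norm (h y) < 1"
    and Y: "\<And>y. y \<ge> Y \<Longrightarrow> norm (h y) < 1"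
    unfolding eventually_at_right_field eventually_at_top_linorder by auto
  have "compact (h ` {d..Y})"
    using d(1) assms(1) by (intro compact_continuous_image) (auto intro: continuous_on_subset)
  from compact_imp_bounded[OF this] obtain B where "\<forall>x\<in>h ` {d..Y}. norm x \<le> B"
    unfolding bounded_iff ..
  then have B: "\<And>y. y \<in> {d..Y} \<Longrightarrow> norm (h y) \<le> B" by simp
  have "norm (h y) \<le> max 1 B" if "y > 0" for y
  proof (cases "y < d \<or> y \<ge> Y")
    case True
    then have "norm (h y) < 1" using d(2) Y that by blast
    then show ?thesis by simp
  next
    case False
    then have "norm (h y) \<le> B" by (intro B) auto
    then show ?thesis by simp
  qed
  then show ?thesis by blast
qed

text \<open>Under these limits \<open>f\<close> is dominated by a multiple of \<open>1 / (1 + y\<^sup>2)\<close>.\<close>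

lemma path_form_of_limits:
  assumes "continuous_on {0<..} f"
    and "((\<lambda>y. (1 + y\<^sup>2) * norm (f y)) \<longlongrightarrow> 0) (at_right 0)"
    and "((\<lambda>y. (1 + y\<^sup>2) * norm (f y)) \<longlongrightarrow> 0) at_top"
  shows "path_form f"
proof -
  have nrm: "norm (of_real (1 + y\<^sup>2) * f y) = (1 + y\<^sup>2) * norm (f y)" for y :: real
    by (simp add: norm_mult del: of_real_add)
  have "\<exists>K. \<forall>y>0. norm (of_real (1 + y\<^sup>2) * f y) \<le> K"
    by (intro bounded_on_half_line continuous_intros assms(1); rule tendsto_norm_zero_cancel)
       (simp_all only: nrm assms(2,3))
  then obtain K where K: "\<And>y. y > 0 \<Longrightarrow> (1 + y\<^sup>2) * norm (f y) \<le> K"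
    unfolding nrm by blast
  have "set_integrable lborel UNIV (\<lambda>y::real. inverse (1 + y\<^sup>2))"
    using integrable_inverse_1_plus_square by simp
  then have "set_integrable lborel {0<..} (\<lambda>y::real. K * inverse (1 + y\<^sup>2))"
    by (intro set_integrable_mult_right) (auto intro: set_integrable_subset[of lborel UNIV])
  then have "set_integrable lborel {0<..} f"
  proof (rule set_integrable_bound)
    show "set_borel_measurable lborel {0<..} f"
      using assms(1) unfolding set_borel_measurable_def by (auto intro!: borel_measurable_continuous_on_indicator)
    have "norm (f y) \<le> norm (K * inverse (1 + y\<^sup>2))" if "y > 0" for y
    proof -
      have p: "1 + y\<^sup>2 > 0" by (simp add: add_pos_nonneg)
      have "norm (f y) \<le> K * inverse (1 + y\<^sup>2)"
        using K[OF that] p by (simp add: field_simps)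
      then show ?thesis by simp
    qed
    then show "AE y in lborel. y \<in> {0<..} \<longrightarrow> norm (f y) \<le> norm (K * inverse (1 + y\<^sup>2))" by auto
  qed
  with assms(1) show ?thesis by (simp add: path_form_def)
qed

text \<open>The factor \<open>\<i>\<close> comes from \<open>dz = \<i> dy\<close>.\<close>

definition on_axis :: "(complex \<Rightarrow> complex) \<Rightarrow> real \<Rightarrow> complex" where
  "on_axis \<omega> y = \<omega> (\<i> * of_real y) * \<i>"

lemma norm_powr_on_axis:
  assumes "y > 0"
  shows "norm ((\<i> * of_real y) powr s) = exp (- Im s * pi / 2) * y powr Re s"
proof -
  have "Ln (\<i> * of_real y) = of_real (ln y) + \<i> * pi / 2"
    using Ln_times_of_real[OF assms, of \<i>] Ln_of_real[OF assms] by (simp add: mult.commute)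
  then have re: "Re (s * Ln (\<i> * of_real y)) = - Im s * pi / 2 + Re s * ln y"
    by simp
  have "norm ((\<i> * of_real y) powr s) = exp (Re (s * Ln (\<i> * of_real y)))"
    using assms by (simp only: powr_def norm_exp_eq_Re) simp
  also have "\<dots> = exp (- Im s * pi / 2) * exp (Re s * ln y)"
    unfolding re by (rule exp_add)
  finally show ?thesis using assms by (simp add: powr_def)
qed

text \<open>The power of \<open>z\<close> grows at most polynomially in \<open>y\<close> and \<open>1/y\<close>, which the exponential decay of the cusp form
  at both cusps outweighs for every complex \<open>s\<close>.\<close>

lemma path_form_mellin_form:
  assumes "congruence_subgroup \<Gamma>" "cusp_form \<Gamma> k f"
  shows "path_form (on_axis (mellin_form f s))"
proof -
  obtain C c Y where c: "c > 0"
    and inf: "\<And>y. y \<ge> Y \<Longrightarrow> norm (f (\<i> * of_real y)) \<le> C * exp (- c * y)"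
    and zero: "\<And>y. y > 0 \<Longrightarrow> 1 / y \<ge> Y \<Longrightarrow> norm (f (\<i> * of_real y)) \<le> C * exp (- c / y) * y powr (- of_int k)"
    by (rule cusp_form_decay[OF assms], rule that)
  define E a where "E = exp (- Im (s - 1) * pi / 2)" and "a = Re (s - 1)"
  have nrm: "norm (on_axis (mellin_form f s) y) = norm (f (\<i> * of_real y)) * (E * y powr a)" if "y > 0" for y
    using norm_powr_on_axis[OF that] by (simp add: on_axis_def mellin_form_def norm_mult E_def a_def)
  have E: "E > 0" by (simp add: E_def)
  show ?thesis
  proof (rule path_form_of_limits)
    have "mellin_form f s holomorphic_on upper_half_plane"
      unfolding mellin_form_def using assms(2)
      by (auto intro!: holomorphic_intros simp: cusp_form_def upper_half_plane_def complex_nonpos_Reals_iff)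
    then have "continuous_on {0<..} (\<lambda>y::real. mellin_form f s (\<i> * of_real y))"
      by (rule continuous_on_compose2[OF holomorphic_on_imp_continuous_on])
         (auto intro!: continuous_intros simp: upper_half_plane_def)
    then show "continuous_on {0<..} (on_axis (mellin_form f s))"
      unfolding on_axis_def by (rule continuous_on_mult_right)
    show "((\<lambda>y. (1 + y\<^sup>2) * norm (on_axis (mellin_form f s) y)) \<longlongrightarrow> 0) at_top"
    proof (rule tendsto_sandwich[OF _ _ tendsto_const])
      have "((\<lambda>y. (1 + y\<^sup>2) * (exp (- c * y) * y powr a)) \<longlongrightarrow> 0) at_top"
        using c by real_asymp
      from tendsto_mult_right_zero[OF this, of "C * E"]
      show "((\<lambda>y. (1 + y\<^sup>2) * (C * exp (- c * y) * (E * y powr a))) \<longlongrightarrow> 0) at_top"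
        by (simp only: mult_ac)
      show "\<forall>\<^sub>F y in at_top. (1 + y\<^sup>2) * norm (on_axis (mellin_form f s) y)
          \<le> (1 + y\<^sup>2) * (C * exp (- c * y) * (E * y powr a))"
        using eventually_ge_at_top[of Y] eventually_gt_at_top[of 0]
      proof eventually_elim
        case (elim y)
        show ?case
          unfolding nrm[OF elim(2)] using elim E by (intro mult_left_mono mult_right_mono inf) simp_all
      qed
    qed auto
    show "((\<lambda>y. (1 + y\<^sup>2) * norm (on_axis (mellin_form f s) y)) \<longlongrightarrow> 0) (at_right 0)"
    proof (rule tendsto_sandwich[OF _ _ tendsto_const])
      have "((\<lambda>y. (1 + y\<^sup>2) * (exp (- c / y) * y powr (- of_int k) * y powr a)) \<longlongrightarrow> 0) (at_right 0)"
        using c by real_asymp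
      from tendsto_mult_right_zero[OF this, of "C * E"]
      show "((\<lambda>y. (1 + y\<^sup>2) * (C * exp (- c / y) * y powr (- of_int k) * (E * y powr a))) \<longlongrightarrow> 0) (at_right 0)"
        by (simp only: mult_ac)
      have "\<forall>\<^sub>F y in at_right (0::real). 1 / y \<ge> Y"
        using filterlim_inverse_at_top_right by (auto simp: filterlim_at_top inverse_eq_divide)
      then show "\<forall>\<^sub>F y in at_right 0. (1 + y\<^sup>2) * norm (on_axis (mellin_form f s) y)
          \<le> (1 + y\<^sup>2) * (C * exp (- c / y) * y powr (- of_int k) * (E * y powr a))"
        using eventually_at_right_less[of 0]
      proof eventually_elim
        case (elim y)
        show ?case
          unfolding nrm[OF elim(2)] using elim E by (intro mult_left_mono mult_right_mono zero) simp_all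
      qed
    qed auto
  qed
qed

section \<open>The functional equations\<close>

lemma deriv_mobius_g_mat:
  assumes "N > 0" "z \<noteq> 0"
  shows "deriv (mobius (g_mat N)) z = 1 / (of_nat N * z\<^sup>2)"
proof (rule DERIV_imp_deriv)
  show "(mobius (g_mat N) has_field_derivative 1 / (of_nat N * z\<^sup>2)) (at z)"
    unfolding mobius_g_mat[abs_def] using assms
    by (auto intro!: derivative_eq_intros simp: power2_eq_square)
qed

lemma on_axis_pullback:
  assumes "N > 0" "y > 0"
  shows "on_axis (pullback_form (mobius (g_mat N)) \<omega>) y = inversion_pullback (real N) (on_axis \<omega>) y"
proof -
  have "- 1 / (of_nat N * (\<i> * of_real y)) = \<i> * of_real (1 / (real N * y))"
    using assms by (simp add: field_simps)
  moreover have "1 / (of_nat N * (\<i> * of_real y)\<^sup>2) = complex_of_real (- 1 / (real N * y\<^sup>2))"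
    by (simp add: power_mult_distrib)
  moreover have "deriv (mobius (g_mat N)) (\<i> * of_real y) = 1 / (of_nat N * (\<i> * of_real y)\<^sup>2)"
    using assms by (intro deriv_mobius_g_mat) auto
  ultimately show ?thesis
    unfolding on_axis_def pullback_form_def inversion_pullback_def
    by (simp only: mobius_g_mat mult_ac)
qed

lemma path_form_cong:
  assumes "\<And>y. y > 0 \<Longrightarrow> f y = g y"
  shows "path_form f \<longleftrightarrow> path_form g"
  unfolding path_form_def using assms
  by (intro arg_cong2[of _ _ _ _ "(\<and>)"] continuous_on_cong set_integrable_cong) auto

text \<open>The total iterated integrals along a path and along the reversed path are inverse to each other: the
  coefficients of their product are those of the composed path, which returns to its starting point.\<close>

lemma nc_is_inverse_of_paths:
  assumes "\<And>v. v \<in> V \<Longrightarrow> path_form (h v)"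
    and "\<And>w. nc_coeff F w = (if set w \<subseteq> V then iterated_integral \<infinity> (map h w) 0 else 0)"
    and "\<And>w. nc_coeff G w = (if set w \<subseteq> V then iterated_integral 0 (map h w) \<infinity> else 0)"
  shows "nc_is_inverse F G"
proof -
  have *: "A * B = 1"
    if A: "\<And>w. nc_coeff A w = (if set w \<subseteq> V then iterated_integral a (map h w) b else 0)"
      and B: "\<And>w. nc_coeff B w = (if set w \<subseteq> V then iterated_integral b (map h w) a else 0)"
      and ab: "0 \<le> a" "0 \<le> b"
    for A B a b
  proof (rule ncfps_eqI)
    fix w
    show "nc_coeff (A * B) w = nc_coeff 1 w"
    proof (cases "set w \<subseteq> V")
      case True
      then have "set (take i w) \<subseteq> V" "set (drop i w) \<subseteq> V" for i
        by (meson order_trans set_take_subset set_drop_subset)+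
      then have "nc_coeff (A * B) w
          = (\<Sum>i\<le>length w. iterated_integral a (map h (take i w)) b * iterated_integral b (map h (drop i w)) a)"
        by (simp add: times_ncfps.rep_eq A B)
      also have "\<dots> = iterated_integral b (map h w) b"
        using iterated_integral_composition[OF _ ab(2,1,2), of "map h w"] assms(1) True
        by (simp add: take_map drop_map subset_iff)
      also have "\<dots> = nc_coeff 1 w"
        by (cases "w = []") (simp_all add: one_ncfps.rep_eq iterated_integral_same)
      finally show ?thesis .
    next
      case False
      have "\<not> (set (take i w) \<subseteq> V \<and> set (drop i w) \<subseteq> V)" for i
        using False by (metis append_take_drop_id set_append le_sup_iff)
      then have "nc_coeff A (take i w) * nc_coeff B (drop i w) = 0" for i
        by (auto simp: A B)
      then have "nc_coeff (A * B) w = 0"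
        unfolding times_ncfps.rep_eq by (intro sum.neutral ballI)
      moreover have "w \<noteq> []" using False by auto
      ultimately show ?thesis by (simp add: one_ncfps.rep_eq)
    qed
  qed
  show ?thesis
    unfolding nc_is_inverse_def using *[OF assms(2,3)] *[OF assms(3,2)] by auto
qed

text \<open>The common form of both functional equations.  The inverse of the integral of \<open>\<alpha>\<close> from \<open>i\<infinity>\<close> to \<open>0\<close> is the
  integral of \<open>\<alpha>\<close> from \<open>0\<close> to \<open>i\<infinity>\<close>, hence the integral of the pull-back of \<open>\<alpha>\<close> from \<open>i\<infinity>\<close> to \<open>0\<close>; and the pull-back
  is expressed linearly by the family \<open>\<beta>\<close>.  Two families are needed because for eigenforms the pull-back
  replaces \<open>s\<close> by \<open>2r - s\<close>.\<close>

lemma total_iter_int_functional_equation: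
  assumes "finite V" "N > 0"
    and pa: "\<And>v. v \<in> V \<Longrightarrow> path_form (on_axis (\<alpha> v))"
    and pb: "\<And>v. v \<in> V \<Longrightarrow> path_form (on_axis (\<beta> v))"
    and pull: "\<And>v z. v \<in> V \<Longrightarrow> z \<in> upper_half_plane \<Longrightarrow>
      pullback_form (mobius (g_mat N)) (\<alpha> v) z = (\<Sum>u\<in>V. G v u * \<beta> u z)"
  shows "nc_is_inverse (total_iter_int V \<alpha>) (nc_subst V G (total_iter_int V \<beta>))"
proof (rule nc_is_inverse_of_paths[where h = "\<lambda>v. on_axis (\<alpha> v)"])
  have iter: "iter_int (map \<omega> w) 0 = iterated_integral \<infinity> (map (\<lambda>v. on_axis (\<omega> v)) w) 0" for \<omega> :: "'a \<Rightarrow> _" and w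
    by (simp add: iter_int_eq_iterated_integral on_axis_def[abs_def] o_def zero_ereal_def)
  show "nc_coeff (total_iter_int V \<alpha>) w
      = (if set w \<subseteq> V then iterated_integral \<infinity> (map (\<lambda>v. on_axis (\<alpha> v)) w) 0 else 0)" for w
    by (simp add: total_iter_int.rep_eq iter)
  have pull': "inversion_pullback (real N) (on_axis (\<alpha> v)) y = (\<Sum>u\<in>V. G v u * on_axis (\<beta> u) y)"
    if "v \<in> V" "y > 0" for v y
    using pull[OF that(1), of "\<i> * of_real y"] that assms(2)
    by (simp add: on_axis_pullback[symmetric] on_axis_def sum_distrib_right mult.assoc upper_half_plane_def)
  have pR: "path_form (inversion_pullback (real N) (on_axis (\<alpha> v)))" if "v \<in> V" for v
    using path_form_sum[OF assms(1), of "\<lambda>u y. G v u * on_axis (\<beta> u) y"] pb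
    by (subst path_form_cong[OF pull'[OF that]]) (auto intro: path_form_cmult)
  show "nc_coeff (nc_subst V G (total_iter_int V \<beta>)) w
      = (if set w \<subseteq> V then iterated_integral 0 (map (\<lambda>v. on_axis (\<alpha> v)) w) \<infinity> else 0)" for w
  proof (cases "set w \<subseteq> V")
    case True
    have "nc_coeff (nc_subst V G (total_iter_int V \<beta>)) w
        = (\<Sum>u\<in>{u. set u \<subseteq> V \<and> length u = length w}.
            prod_list (map2 G w u) * iterated_integral \<infinity> (map (\<lambda>v. on_axis (\<beta> v)) u) 0)"
      using True by (simp add: nc_subst.rep_eq total_iter_int.rep_eq iter)
    also have "\<dots> = iterated_integral \<infinity> (map (\<lambda>v y. \<Sum>u\<in>V. G v u * on_axis (\<beta> u) y) w) 0"
      using assms(1) pb by (intro iterated_integral_multilinear[symmetric]) auto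
    also have "\<dots> = iterated_integral \<infinity> (map (inversion_pullback (real N)) (map (\<lambda>v. on_axis (\<alpha> v)) w)) 0"
      using True pull' by (intro iterated_integral_cong) (auto simp: list_all2_conv_all_nth subset_iff)
    also have "\<dots> = iterated_integral 0 (map (\<lambda>v. on_axis (\<alpha> v)) w) \<infinity>"
      using iterated_integral_inversion[of "real N" "map (\<lambda>v. on_axis (\<alpha> v)) w" 0] pa pR True assms(2)
      by (auto simp: subset_iff zero_ereal_def)
    finally show ?thesis using True by simp
  qed (simp add: nc_subst.rep_eq)
qed (use pa in auto)

lemma stable_imp_g_action_matrix:
  assumes "finite V" "g_stable N (form_span V \<omega>)"
  shows "\<exists>G. g_action_matrix N V \<omega> G"
proof -
  have "\<exists>c. \<forall>z\<in>upper_half_plane. pullback_form (mobius (g_mat N)) (\<omega> v) z = (\<Sum>u\<in>V. c u * \<omega> u z)"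
    if "v \<in> V" for v
  proof -
    have "\<omega> v z = (\<Sum>u\<in>V. (if u = v then 1 else 0) * \<omega> u z)" for z
      using assms(1) that by (simp add: if_distrib[of "\<lambda>x. x * _"] cong: if_cong)
    then have "\<omega> v \<in> form_span V \<omega>"
      unfolding form_span_def by (auto intro!: exI[of _ "\<lambda>u. if u = v then 1 else 0"])
    then show ?thesis using assms(2) by (auto simp: g_stable_def form_span_def)
  qed
  then show ?thesis unfolding g_action_matrix_def by (intro bchoice ballI)
qed

text \<open>Substituting \<open>-1/(Nz)\<close> contributes \<open>\<epsilon> N\<^bsup>-r\<^esup> (Nz)\<^bsup>2r\<^esup>\<close> from the form, \<open>(-1)\<^bsup>s-1\<^esup> (Nz)\<^bsup>1-s\<^esup>\<close> from the power and
  \<open>1/(Nz\<^sup>2)\<close> from the differential; the exponents of \<open>N\<close> add up to \<open>r - s\<close> and those of \<open>z\<close> to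
  \<open>2r - s - 1\<close>.\<close>

lemma pullback_mellin_form:
  assumes "N > 0" "z \<in> upper_half_plane" "of_int k = 2 * (r :: real)" "g_eigenform N k \<epsilon> f"
  shows "pullback_form (mobius (g_mat N)) (mellin_form f s) z
    = \<epsilon> * of_nat N powr (of_real r - s) * (-1) powr (s - 1) * mellin_form f (2 * of_real r - s) z"
proof -
  have z: "z \<noteq> 0" using assms(2) by (auto simp: upper_half_plane_def)
  let ?N = "of_nat N :: complex"
  have N: "?N \<noteq> 0" using assms(1) by simp
  have k: "of_int k / 2 = complex_of_real r" "of_int k = 2 * complex_of_real r"
    using arg_cong[OF assms(3), of complex_of_real] by auto
  have "?N powr of_real r * f (mobius (g_mat N) z) * (?N * z) powi (- k) = \<epsilon> * f z"
    using assms(2,4) by (simp add: g_eigenform_def g_pullback_diff_def k(1))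
  then have f: "f (mobius (g_mat N) z) = \<epsilon> * f z * (?N * z) powi k * ?N powr (- of_real r)"
    using N z by (simp add: power_int_minus powr_minus field_simps)
  have pw: "(?N * z) powi k = ?N powr (2 * of_real r) * z powr (2 * of_real r)"
    unfolding k(2)[symmetric] using N z by (simp add: power_int_mult_distrib complex_powr_of_int)
  have d: "1 / (?N * z\<^sup>2) = ?N powr (-1) * z powr (-2)"
    using N z by (simp add: powr_minus divide_inverse)
  have "pullback_form (mobius (g_mat N)) (mellin_form f s) z
      = \<epsilon> * f z * (-1) powr (s - 1)
        * (?N powr (2 * of_real r) * ?N powr (- of_real r) * ?N powr (1 - s) * ?N powr (-1))
        * (z powr (2 * of_real r) * z powr (1 - s) * z powr (-2))"
    unfolding pullback_form_def mellin_form_def powr_g_mat[OF assms(1,2)] f pw deriv_mobius_g_mat[OF assms(1) z] d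
    by (simp only: mult_ac)
  also have "?N powr (2 * of_real r) * ?N powr (- of_real r) * ?N powr (1 - s) * ?N powr (-1) = ?N powr (of_real r - s)"
    by (simp add: powr_add[symmetric])
  also have "z powr (2 * of_real r) * z powr (1 - s) * z powr (-2) = z powr (2 * of_real r - s - 1)"
    by (simp only: powr_add[symmetric]) simp
  finally show ?thesis
    unfolding mellin_form_def[of f "2 * of_real r - s" z] by (simp only: mult_ac)
qed

theorem theorem2p3:
  fixes V :: "'v set" and \<Gamma> :: "(int^2^2) set" and k :: "'v \<Rightarrow> int"
    and f :: "'v \<Rightarrow> complex \<Rightarrow> complex" and s :: "'v \<Rightarrow> complex" and N :: nat
    and \<omega> :: "'v \<Rightarrow> complex \<Rightarrow> complex"
  assumes "finite V"
    and "congruence_subgroup \<Gamma>"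
    and "\<forall>v\<in>V. cusp_form \<Gamma> (k v) (f v)"
    and "\<omega> = (\<lambda>v. mellin_form (f v) (s v))"
    and "N > 0"
  shows
    "(g_stable N (form_span V \<omega>) \<longrightarrow>
        (\<exists>G. g_action_matrix N V \<omega> G) \<and>
        (\<forall>G. g_action_matrix N V \<omega> G \<longrightarrow>
           nc_is_inverse (total_iter_int V \<omega>) (nc_subst V G (total_iter_int V \<omega>))))
     \<and>
     (\<forall>(r :: 'v \<Rightarrow> real) (\<epsilon> :: 'v \<Rightarrow> complex).
        (\<forall>v\<in>V. of_int (k v) = 2 * r v \<and> g_eigenform N (k v) (\<epsilon> v) (f v)) \<longrightarrow>
        nc_is_inverse
          (total_mellin V f s)
          (nc_subst V
             (diag_coeffs (\<lambda>v. \<epsilon> v * of_nat N powr (of_real (r v) - s v) * (-1) powr (s v - 1)))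
             (total_mellin V f (\<lambda>v. 2 * of_real (r v) - s v))))"
proof (intro conjI impI allI)
  have pf: "path_form (on_axis (mellin_form (f v) t))" if "v \<in> V" for v t
    using path_form_mellin_form assms(2,3) that by blast
  show "\<exists>G. g_action_matrix N V \<omega> G" if "g_stable N (form_span V \<omega>)"
    using stable_imp_g_action_matrix[OF assms(1) that] .
  show "nc_is_inverse (total_iter_int V \<omega>) (nc_subst V G (total_iter_int V \<omega>))"
    if "g_action_matrix N V \<omega> G" for G
    using that pf assms(1,4,5)
    by (intro total_iter_int_functional_equation[where N = N]) (auto simp: g_action_matrix_def)
  fix r :: "'v \<Rightarrow> real" and \<epsilon> :: "'v \<Rightarrow> complex"
  assume eig: "\<forall>v\<in>V. of_int (k v) = 2 * r v \<and> g_eigenform N (k v) (\<epsilon> v) (f v)"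
  show "nc_is_inverse (total_mellin V f s)
          (nc_subst V
             (diag_coeffs (\<lambda>v. \<epsilon> v * of_nat N powr (of_real (r v) - s v) * (-1) powr (s v - 1)))
             (total_mellin V f (\<lambda>v. 2 * of_real (r v) - s v)))"
    unfolding total_mellin_def
  proof (rule total_iter_int_functional_equation[OF assms(1,5)])
    fix v z assume "v \<in> V" "z \<in> upper_half_plane"
    then show "pullback_form (mobius (g_mat N)) (mellin_form (f v) (s v)) z
       = (\<Sum>u\<in>V. diag_coeffs (\<lambda>v. \<epsilon> v * of_nat N powr (of_real (r v) - s v) * (-1) powr (s v - 1)) v u
            * mellin_form (f u) (2 * of_real (r u) - s u) z)"
      using pullback_mellin_form[OF assms(5), of z "k v" "r v" "\<epsilon> v" "f v" "s v"] eig assms(1)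
      by (simp add: diag_coeffs_def if_distrib[of "\<lambda>x. x * _"] cong: if_cong)
  qed (use pf in auto)
qed

end
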